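(* Let $k\ge 2$, let $G$ be a $k$-uniform supertree, let $e$ be a non-pendent edge of $G$ and $u\in e$, and let $G'$ be the supertree obtained from $G$ by edge-releasing the edge $e$ at $u$. Then $$\rho(\mathcal{A}(G'))>\rho(\mathcal{A}(G)),\qquad \rho(\mathcal{Q}(G'))>\rho(\mathcal{Q}(G)),\qquad \rho(\mathcal{Q}^{*}(G'))>\rho(\mathcal{Q}^{*}(G)).$$
   Context: Hypergraphs. A $k$-uniform hypergraph $G=(V,E)$ has finite vertex set $V=[n]=\{1,\dots,n\}$ and a set $E$ of $k$-element subsets of $V$ (the edges; no repeated edges). The degree $d_i$ of a vertex $i$ is the number of edges containing $i$. A path of length $q$ is a sequence $v_1,e_1,v_2,\dots,v_q,e_q,v_{q+1}$ with distinct vertices $v_1,\dots,v_{q+1}$, distinct edges $e_1,\dots,e_q$, and $v_r,v_{r+1}\in e_r$ for all $r$. A cycle of length $q>1$ is such a sequence in which $v_1,\dots,v_q$ are distinct, $e_1,\dots,e_q$ are distinct and $v_{q+1}=v_1$. $G$ is connected if any two vertices are joined by a path, acyclic if it has no cycle. A supertree is a connected acyclic hypergraph. In a supertree any two distinct edges share at most one vertex (i.e. it is a linear hypergraph). Two edges are adjacent if they intersect. An edge is pendent if it contains exactly $k-1$ vertices of degree one, and non-pendent otherwise. Edge-releasing: let $G$ be a $k$-uniform linear hypergraph, $e$ a non-pendent edge and $u\in e$. Let $e_1,\dots,e_r$ ($r\ge1$) be all the edges of $G$ that are adjacent to $e$ (and different from $e$) but do not contain $u$, and let $e_i\cap e=\{v_i\}$.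 The hypergraph $G'$ obtained from $G$ by edge-releasing $e$ at $u$ has the same vertex set and is obtained by replacing each $e_i$ by $e_i'=(e_i\setminus\{v_i\})\cup\{u\}$, $i=1,\dots,r$. The operation requires that there is at least one such edge, i.e. $r\ge1$. When $G$ is a supertree, $G'$ has no multiple edges and is again a supertree. Tensors. For a real order-$k$ dimension-$n$ tensor $\mathcal{T}=(\mathcal{T}_{i_1\cdots i_k})$ and $x\in\mathbb{C}^n$, $\mathcal{T}x\in\mathbb{C}^n$ is defined by $(\mathcal{T}x)_i=\sum_{i_2,\dots,i_k=1}^n\mathcal{T}_{ii_2\cdots i_k}x_{i_2}\cdots x_{i_k}$. A number $\lambda\in\mathbb{C}$ is an eigenvalue of $\mathcal{T}$ with eigenvector $0\ne x\in\mathbb{C}^n$ if $(\mathcal{T}x)_i=\lambda x_i^{k-1}$ for all $i$. The spectral radius $\rho(\mathcal{T})$ is the maximum modulus of an eigenvalue of $\mathcal{T}$. For a $k$-uniform hypergraph $G$: the adjacency tensor $\mathcal{A}(G)$ has entries $a_{i_1\cdots i_k}=\frac1{(k-1)!}$ if $\{i_1,\dots,i_k\}\in E$ and $0$ otherwise; the signless Laplacian tensor is $\mathcal{Q}(G)=\mathcal{D}(G)+\mathcal{A}(G)$ where $\mathcal{D}(G)$ is the diagonal tensor with $\mathcal{D}_{i\cdots i}=d_i$; the incidence $Q$-tensor $\mathcal{Q}^*(G)$ has $(i_1,\dots,i_k)$-entry equal to the number of edges $e$ with $i_t\in e$ for all $t=1,\dots,k$ (indices may repeat). *)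

theory Defs
  imports "HOL-Analysis.Analysis"
begin

section \<open>Uniform hypergraphs and supertrees\<close>

text \<open>A hypergraph on the vertex set \<open>{1..n}\<close> is given by \<open>n\<close> and its set \<open>E\<close> of edges.\<close>

definition uniform_hypergraph :: "nat \<Rightarrow> nat \<Rightarrow> nat set set \<Rightarrow> bool" where
  "uniform_hypergraph k n E \<longleftrightarrow> (\<forall>e\<in>E. e \<subseteq> {1..n} \<and> card e = k)"

definition vertex_degree :: "nat set set \<Rightarrow> nat \<Rightarrow> nat" where
  "vertex_degree E i = card {e \<in> E. i \<in> e}"

text \<open>The sequence \<open>v\<^sub>1, e\<^sub>1, v\<^sub>2, \<dots>, v\<^sub>q, e\<^sub>q, v\<^sub>q\<^sub>+\<^sub>1\<close> is split into its list of
  vertices and its list of edges; the length \<open>q\<close> is the number of edges.\<close>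

definition hyper_walk :: "nat set set \<Rightarrow> nat list \<Rightarrow> nat set list \<Rightarrow> bool" where
  "hyper_walk E vs es \<longleftrightarrow>
     length vs = length es + 1 \<and> set es \<subseteq> E \<and>
     (\<forall>r<length es. vs ! r \<in> es ! r \<and> vs ! (r + 1) \<in> es ! r)"

definition hyper_path :: "nat set set \<Rightarrow> nat list \<Rightarrow> nat set list \<Rightarrow> bool" where
  "hyper_path E vs es \<longleftrightarrow> hyper_walk E vs es \<and> distinct vs \<and> distinct es"

definition hyper_cycle :: "nat set set \<Rightarrow> nat list \<Rightarrow> nat set list \<Rightarrow> bool" where
  "hyper_cycle E vs es \<longleftrightarrow>
     hyper_walk E vs es \<and> length es > 1 \<and>
     distinct (butlast vs) \<and> distinct es \<and> last vs = hd vs"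

definition hyper_connected :: "nat \<Rightarrow> nat set set \<Rightarrow> bool" where
  "hyper_connected n E \<longleftrightarrow>
     (\<forall>u\<in>{1..n}. \<forall>v\<in>{1..n}. u \<noteq> v \<longrightarrow>
        (\<exists>vs es. hyper_path E vs es \<and> hd vs = u \<and> last vs = v))"

definition hyper_acyclic :: "nat set set \<Rightarrow> bool" where
  "hyper_acyclic E \<longleftrightarrow> \<not> (\<exists>vs es. hyper_cycle E vs es)"

definition uniform_supertree :: "nat \<Rightarrow> nat \<Rightarrow> nat set set \<Rightarrow> bool" where
  "uniform_supertree k n E \<longleftrightarrow>
     uniform_hypergraph k n E \<and> hyper_connected n E \<and> hyper_acyclic E"

section \<open>Edge-releasing\<close>

definition pendent_edge :: "nat \<Rightarrow> nat set set \<Rightarrow> nat set \<Rightarrow> bool" where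
  "pendent_edge k E e \<longleftrightarrow> card {v \<in> e. vertex_degree E v = 1} = k - 1"

text \<open>The edges \<open>e\<^sub>1, \<dots>, e\<^sub>r\<close> that are moved. This set may be empty: an edge that is the
  only edge of the hypergraph has \<open>k\<close> vertices of degree one, hence is not pendent.\<close>

definition edges_to_move :: "nat set set \<Rightarrow> nat set \<Rightarrow> nat \<Rightarrow> nat set set" where
  "edges_to_move E e u = {f \<in> E. f \<noteq> e \<and> f \<inter> e \<noteq> {} \<and> u \<notin> f}"

text \<open>In a linear hypergraph the intersection with \<open>e\<close> of each moved edge is a
  singleton, so that \<open>the_elem\<close> is meaningful.\<close>

definition edge_releasing :: "nat set set \<Rightarrow> nat set \<Rightarrow> nat \<Rightarrow> nat set set" where
  "edge_releasing E e u =
     (E - edges_to_move E e u) \<union>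
     (\<lambda>f. (f - {the_elem (f \<inter> e)}) \<union> {u}) ` edges_to_move E e u"

section \<open>Tensors\<close>

text \<open>A real tensor of order \<open>k\<close> and dimension \<open>n\<close> is a function on index lists, of which
  only the values on lists of length \<open>k\<close> with entries in \<open>{1..n}\<close> matter; similarly, of
  a vector only the components in \<open>{1..n}\<close> matter.\<close>

definition tensor_apply ::
    "nat \<Rightarrow> nat \<Rightarrow> (nat list \<Rightarrow> real) \<Rightarrow> (nat \<Rightarrow> complex) \<Rightarrow> nat \<Rightarrow> complex" where
  "tensor_apply k n T x i =
     (\<Sum>js | length js = k - 1 \<and> set js \<subseteq> {1..n}.
        complex_of_real (T (i # js)) * (\<Prod>j\<leftarrow>js. x j))"

definition tensor_eigenvalue :: "nat \<Rightarrow> nat \<Rightarrow> (nat list \<Rightarrow> real) \<Rightarrow> complex \<Rightarrow> bool" where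
  "tensor_eigenvalue k n T lam \<longleftrightarrow>
     (\<exists>x. (\<exists>i\<in>{1..n}. x i \<noteq> 0) \<and>
          (\<forall>i\<in>{1..n}. tensor_apply k n T x i = lam * x i ^ (k - 1)))"

text \<open>For \<open>k \<ge> 2\<close> and \<open>n \<ge> 1\<close> a tensor has finitely many eigenvalues and at least one, so
  the maximum exists.\<close>

definition tensor_spectral_radius :: "nat \<Rightarrow> nat \<Rightarrow> (nat list \<Rightarrow> real) \<Rightarrow> real" where
  "tensor_spectral_radius k n T =
     (GREATEST r. r \<in> {cmod lam | lam. tensor_eigenvalue k n T lam})"

definition adjacency_tensor :: "nat \<Rightarrow> nat set set \<Rightarrow> nat list \<Rightarrow> real" where
  "adjacency_tensor k E js = (if set js \<in> E then 1 / fact (k - 1) else 0)"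

definition degree_tensor :: "nat set set \<Rightarrow> nat list \<Rightarrow> real" where
  "degree_tensor E js =
     (case js of [] \<Rightarrow> 0
      | i # is \<Rightarrow> if \<forall>j\<in>set is. j = i then real (vertex_degree E i) else 0)"

definition signless_laplacian_tensor :: "nat \<Rightarrow> nat set set \<Rightarrow> nat list \<Rightarrow> real" where
  "signless_laplacian_tensor k E js = degree_tensor E js + adjacency_tensor k E js"

definition incidence_Q_tensor :: "nat set set \<Rightarrow> nat list \<Rightarrow> real" where
  "incidence_Q_tensor E js = real (card {e \<in> E. \<forall>j\<in>set js. j \<in> e})"

end

theory Submission
  imports Defs
begin

text \<open>For a nonnegative tensor \<open>T\<close> of order \<open>k\<close> whose entries depend only on the set of indices,
  the spectral radius is the maximum of the form \<open>T x\<^sup>k\<close> over the vectors \<open>x \<ge> 0\<close> with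
  \<open>\<Sum>\<^sub>i x\<^sub>i\<^sup>k = 1\<close>: a maximizer satisfies the eigenvalue equation
  (\<open>maximizer_eigen_equation\<close>), and no eigenvalue exceeds the maximum in modulus
  (\<open>eigenvalue_bound\<close>).  All three tensors have this shape, and moreover
  they are sums over the edges of one and the same kind, with different weights \<open>h\<close>; so they are
  treated simultaneously.

  Let \<open>x\<close> be a maximizer for \<open>E\<close>, which is positive as \<open>E\<close> is connected
  (\<open>maximizer_positive\<close>), and let \<open>w\<close> be a vertex of \<open>e\<close> at which \<open>x\<close> is largest on \<open>e\<close>.
  Let \<open>y\<close> be \<open>x\<close> with the values at \<open>u\<close> and \<open>w\<close> exchanged.  An edge that meets \<open>e\<close> in \<open>v\<close>
  becomes an edge in which \<open>v\<close> is replaced by \<open>u\<close>, and \<open>y\<^sub>u = x\<^sub>w \<ge> x\<^sub>v\<close>; all other edges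
  contribute the same as before.  Hence the form of \<open>E'\<close> at \<open>y\<close> is at least the form of \<open>E\<close> at
  \<open>x\<close>, and the spectral radius does not decrease.  Here it matters that distinct edges stay
  distinct (\<open>released_edge_inj\<close>).

  If the spectral radius did not increase, \<open>y\<close> would be a maximizer for \<open>E'\<close>, and therefore
  satisfy the eigenvalue equation at \<open>u\<close>, with the same right-hand side as the equation of \<open>x\<close>
  at \<open>w\<close>.  But on the left-hand side the edges through \<open>w\<close> contribute the same, while an
  edge that met \<open>e\<close> outside \<open>w\<close> contributes a positive amount only after the release.  Such an
  edge exists because \<open>e\<close> is not pendent (\<open>nonpendent_edge_off_vertex\<close>).\<close>

section \<open>Homogeneous forms of symmetric tensors\<close>

text \<open>The three tensors are symmetric in a strong sense: an entry depends only on the set of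
  its indices.  For such a tensor \<open>T js = g (set js)\<close> of order \<open>m\<close> and dimension \<open>n\<close> this is the
  homogeneous form \<open>T x\<^sup>m\<close>.  The vector \<open>(T x)\<^sub>i\<close> is again such a form, of order \<open>m - 1\<close> and
  with weight \<open>\<lambda>S. g (insert i S)\<close>.\<close>
definition tensor_form :: "nat \<Rightarrow> nat \<Rightarrow> (nat set \<Rightarrow> real) \<Rightarrow> (nat \<Rightarrow> real) \<Rightarrow> real" where
  "tensor_form n m g x =
     (\<Sum>js | length js = m \<and> set js \<subseteq> {1..n}. g (set js) * (\<Prod>j\<leftarrow>js. x j))"

text \<open>The \<open>k\<close>-th power of the \<open>k\<close>-norm of a nonnegative vector.\<close>
definition power_sum :: "nat \<Rightarrow> nat \<Rightarrow> (nat \<Rightarrow> real) \<Rightarrow> real" where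
  "power_sum n k x = (\<Sum>i=1..n. x i ^ k)"

lemma finite_index_lists: "finite {js. length js = m \<and> set js \<subseteq> {1..n::nat}}"
proof -
  have "finite {js. set js \<subseteq> {1..n} \<and> length js = m}"
    by (rule finite_lists_length_eq) simp
  then show ?thesis by (simp add: conj_commute)
qed

lemma prod_list_nonneg_real:
  fixes x :: "nat \<Rightarrow> real"
  assumes "\<And>j. j \<in> set js \<Longrightarrow> 0 \<le> x j"
  shows "0 \<le> (\<Prod>j\<leftarrow>js. x j)"
  using assms by (induction js) auto

lemma prod_list_mono_real:
  fixes x z :: "nat \<Rightarrow> real"
  assumes "\<And>j. j \<in> set js \<Longrightarrow> 0 \<le> x j \<and> x j \<le> z j"
  shows "(\<Prod>j\<leftarrow>js. x j) \<le> (\<Prod>j\<leftarrow>js. z j)"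
  using assms
proof (induction js)
  case (Cons a js)
  have "0 \<le> (\<Prod>j\<leftarrow>js. x j)" by (rule prod_list_nonneg_real) (use Cons.prems in auto)
  moreover have "(\<Prod>j\<leftarrow>js. x j) \<le> (\<Prod>j\<leftarrow>js. z j)" using Cons by auto
  moreover have "0 \<le> x a" "x a \<le> z a" using Cons.prems by auto
  ultimately show ?case by (auto intro!: mult_mono)
qed simp

lemma tensor_form_0: "tensor_form n 0 g x = g {}"
proof -
  have "{js. length js = 0 \<and> set js \<subseteq> {1..n}} = {[]}" by auto
  then show ?thesis by (simp add: tensor_form_def)
qed

lemma tensor_form_Suc:
  "tensor_form n (Suc m) g x = (\<Sum>i=1..n. x i * tensor_form n m (\<lambda>S. g (insert i S)) x)"
proof -
  let ?L = "\<lambda>m. {js. length js = m \<and> set js \<subseteq> {1..n}}"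
  let ?c = "\<lambda>(i, js). i # js"
  have eq: "?L (Suc m) = ?c ` ({1..n} \<times> ?L m)"
  proof (intro equalityI subsetI)
    fix js assume "js \<in> ?L (Suc m)"
    then obtain i js' where "js = i # js'" "i \<in> {1..n}" "js' \<in> ?L m"
      by (cases js) auto
    then show "js \<in> ?c ` ({1..n} \<times> ?L m)" by (auto intro!: image_eqI[of _ _ "(i, js')"])
  qed auto
  have inj: "inj_on ?c ({1..n} \<times> ?L m)" by (auto simp: inj_on_def)
  have "tensor_form n (Suc m) g x
      = (\<Sum>p\<in>{1..n} \<times> ?L m. g (set (?c p)) * (\<Prod>j\<leftarrow>?c p. x j))"
    unfolding tensor_form_def eq by (subst sum.reindex[OF inj]) (simp add: o_def)
  also have "\<dots> = (\<Sum>i=1..n. \<Sum>js\<in>?L m. g (insert i (set js)) * (x i * (\<Prod>j\<leftarrow>js. x j)))"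
    by (subst sum.cartesian_product) (rule sum.cong[OF refl], clarsimp simp del: insert_iff)
  also have "\<dots> = (\<Sum>i=1..n. x i * tensor_form n m (\<lambda>S. g (insert i S)) x)"
    unfolding tensor_form_def sum_distrib_left by (intro sum.cong refl) (simp add: algebra_simps)
  finally show ?thesis .
qed

lemma tensor_form_cong:
  assumes "\<And>S j. S \<subseteq> {1..n} \<Longrightarrow> g S \<noteq> 0 \<Longrightarrow> j \<in> S \<Longrightarrow> x j = z j"
  shows "tensor_form n m g x = tensor_form n m g z"
  unfolding tensor_form_def
proof (rule sum.cong[OF refl])
  fix js assume js: "js \<in> {js. length js = m \<and> set js \<subseteq> {1..n}}"
  show "g (set js) * (\<Prod>j\<leftarrow>js. x j) = g (set js) * (\<Prod>j\<leftarrow>js. z j)"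
  proof (cases "g (set js) = 0")
    case False
    then have "map x js = map z js" using assms js by auto
    then show ?thesis by presburger
  qed simp
qed

lemma tensor_form_mono:
  assumes "\<And>S. g S \<ge> 0"
    and "\<And>S j. S \<subseteq> {1..n} \<Longrightarrow> g S \<noteq> 0 \<Longrightarrow> j \<in> S \<Longrightarrow> 0 \<le> x j \<and> x j \<le> z j"
  shows "tensor_form n m g x \<le> tensor_form n m g z"
  unfolding tensor_form_def
proof (rule sum_mono)
  fix js assume js: "js \<in> {js. length js = m \<and> set js \<subseteq> {1..n}}"
  show "g (set js) * (\<Prod>j\<leftarrow>js. x j) \<le> g (set js) * (\<Prod>j\<leftarrow>js. z j)"
  proof (cases "g (set js) = 0")
    case False
    then show ?thesis using assms js by (intro mult_left_mono prod_list_mono_real) auto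
  qed simp
qed

lemma tensor_form_nonneg:
  assumes "\<And>S. g S \<ge> 0" and "\<And>j. j \<in> {1..n} \<Longrightarrow> 0 \<le> x j"
  shows "0 \<le> tensor_form n m g x"
  unfolding tensor_form_def
  using assms by (intro sum_nonneg mult_nonneg_nonneg prod_list_nonneg_real) auto

lemma tensor_form_scale: "tensor_form n m g (\<lambda>j. c * x j) = c ^ m * tensor_form n m g x"
proof (induction m arbitrary: g)
  case 0
  then show ?case by (simp add: tensor_form_0)
next
  case (Suc m)
  show ?case unfolding tensor_form_Suc Suc.IH sum_distrib_left
    by (intro sum.cong refl) (simp add: algebra_simps)
qed

lemma tensor_form_sum:
  "tensor_form n m (\<lambda>S. \<Sum>f\<in>E. w f S) x = (\<Sum>f\<in>E. tensor_form n m (w f) x)"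
  unfolding tensor_form_def sum_distrib_right by (rule sum.swap)

lemma tensor_form_permute:
  assumes "\<sigma> permutes {1..n}"
  shows "tensor_form n m g y = tensor_form n m (\<lambda>S. g (\<sigma> ` S)) (y \<circ> \<sigma>)"
proof (induction m arbitrary: g)
  case 0
  then show ?case by (simp add: tensor_form_0)
next
  case (Suc m)
  have "tensor_form n (Suc m) g y
      = (\<Sum>i=1..n. y i * tensor_form n m (\<lambda>S. g (insert i S)) y)"
    by (rule tensor_form_Suc)
  also have "\<dots> = (\<Sum>i=1..n. y (\<sigma> i) * tensor_form n m (\<lambda>S. g (insert (\<sigma> i) S)) y)"
    using sum.permute[OF assms, of "\<lambda>i. y i * tensor_form n m (\<lambda>S. g (insert i S)) y"]
    by (simp add: o_def)
  also have "\<dots> = (\<Sum>i=1..n. (y \<circ> \<sigma>) i * tensor_form n m (\<lambda>S. g (\<sigma> ` insert i S)) (y \<circ> \<sigma>))"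
    by (subst Suc.IH) simp
  also have "\<dots> = tensor_form n (Suc m) (\<lambda>S. g (\<sigma> ` S)) (y \<circ> \<sigma>)"
    by (rule tensor_form_Suc[symmetric])
  finally show ?case .
qed

lemma power_sum_permute:
  assumes "\<sigma> permutes {1..n}"
  shows "power_sum n k (y \<circ> \<sigma>) = power_sum n k y"
  using sum.permute[OF assms, of "\<lambda>i. y i ^ k"] by (simp add: power_sum_def o_def)

text \<open>The partial derivative of \<open>T x\<^sup>m\<close> in the direction \<open>i\<close> is \<open>m (T x)\<^sub>i\<close>.  Because the weights
  depend only on the index set, the induction on the order needs no separate treatment of the
  position of \<open>i\<close> in the index list.\<close>
lemma tensor_form_has_derivative:
  assumes i: "i \<in> {1..n}"
  shows "((\<lambda>t. tensor_form n m g (x(i := x i + t))) has_real_derivative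
           real m * tensor_form n (m - 1) (\<lambda>S. g (insert i S)) x) (at 0)"
proof (induction m arbitrary: g)
  case 0
  then show ?case by (simp add: tensor_form_0)
next
  case (Suc m)
  let ?y = "\<lambda>t. x(i := x i + t)"
  let ?D = "\<lambda>g. tensor_form n (m - 1) (\<lambda>S. g (insert i S)) x"
  let ?g = "\<lambda>j S. g (insert j S)"
  have y0: "?y 0 = x" by simp
  have d: "((\<lambda>t. ?y t j) has_real_derivative (if j = i then 1 else 0)) (at 0)" for j
    by (cases "j = i") (auto intro!: derivative_eq_intros)
  have "((\<lambda>t. \<Sum>j=1..n. ?y t j * tensor_form n m (?g j) (?y t)) has_real_derivative
      (\<Sum>j=1..n. (if j = i then 1 else 0) * tensor_form n m (?g j) (?y 0)
               + (real m * ?D (?g j)) * ?y 0 j)) (at 0)"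
    by (intro DERIV_sum DERIV_mult d Suc.IH)
  moreover have "(\<Sum>j=1..n. (if j = i then 1 else 0) * tensor_form n m (?g j) (?y 0)
               + (real m * ?D (?g j)) * ?y 0 j)
      = tensor_form n m (?g i) x + real m * (\<Sum>j=1..n. x j * ?D (?g j))"
  proof -
    have "(\<Sum>j=1..n. (if j = i then 1 else 0) * tensor_form n m (?g j) x)
        = (\<Sum>j=1..n. if j = i then tensor_form n m (?g j) x else 0)"
      by (intro sum.cong) auto
    also have "\<dots> = tensor_form n m (?g i) x" using i by simp
    finally show ?thesis
      unfolding y0 sum.distrib sum_distrib_left by (simp only: mult_ac)
  qed
  moreover have "real m * (\<Sum>j=1..n. x j * ?D (?g j)) = real m * tensor_form n m (?g i) x"
  proof (cases m)
    case (Suc m')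
    have "tensor_form n m (?g i) x = (\<Sum>j=1..n. x j * ?D (?g j))"
      unfolding Suc tensor_form_Suc by (simp add: insert_commute)
    then show ?thesis by simp
  qed simp
  ultimately have "((\<lambda>t. tensor_form n (Suc m) g (?y t)) has_real_derivative
      tensor_form n m (?g i) x + real m * tensor_form n m (?g i) x) (at 0)"
    unfolding tensor_form_Suc by (simp only:)
  moreover have "tensor_form n m (?g i) x + real m * tensor_form n m (?g i) x
      = real (Suc m) * tensor_form n (Suc m - 1) (?g i) x"
    by (simp add: algebra_simps)
  ultimately show ?case by (simp only:)
qed

lemma power_sum_upd:
  assumes "i \<in> {1..n}"
  shows "power_sum n k (x(i := a)) = power_sum n k x - x i ^ k + a ^ k"
proof -
  have "(\<Sum>j\<in>{1..n}-{i}. (x(i := a)) j ^ k) = (\<Sum>j\<in>{1..n}-{i}. x j ^ k)"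
    by (intro sum.cong) auto
  then show ?thesis unfolding power_sum_def
    using sum.remove[OF _ assms, of "\<lambda>j. x j ^ k"] sum.remove[OF _ assms, of "\<lambda>j. (x(i:=a)) j ^ k"]
    by simp
qed

section \<open>The spectral radius as a maximum\<close>

text \<open>A maximizer satisfies the eigenvalue equation also at coordinates that vanish: there the
  one-sided derivative gives \<open>(T x)\<^sub>i \<le> 0\<close>, which nonnegativity turns into an equality because
  \<open>x\<^sub>i\<^sup>k\<^sup>-\<^sup>1 = 0\<close> for \<open>k \<ge> 2\<close>.\<close>
lemma maximizer_eigen_equation:
  assumes k: "k \<ge> 2" and i: "i \<in> {1..n}"
    and g: "\<And>S. g S \<ge> 0"
    and x: "\<And>j. j \<in> {1..n} \<Longrightarrow> 0 \<le> x j"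
    and max: "\<And>z. (\<And>j. j \<in> {1..n} \<Longrightarrow> 0 \<le> z j) \<Longrightarrow> tensor_form n k g z \<le> M * power_sum n k z"
    and eq: "tensor_form n k g x = M * power_sum n k x"
  shows "tensor_form n (k - 1) (\<lambda>S. g (insert i S)) x = M * x i ^ (k - 1)"
proof -
  let ?T = "tensor_form n (k - 1) (\<lambda>S. g (insert i S)) x"
  define G where "G t = tensor_form n k g (x(i := x i + t)) - M * power_sum n k (x(i := x i + t))" for t
  define D where "D = real k * (?T - M * x i ^ (k - 1))"
  have "((\<lambda>t. M * (power_sum n k x - x i ^ k + (x i + t) ^ k)) has_real_derivative
          M * (real k * x i ^ (k - 1))) (at 0)"
    by (auto intro!: derivative_eq_intros)
  then have "(G has_real_derivative D) (at 0)"
    unfolding G_def D_def power_sum_upd[OF i]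
    by (rule DERIV_cong[OF DERIV_diff[OF tensor_form_has_derivative[OF i]]])
      (simp add: algebra_simps)
  note G' = this
  have G0: "G 0 = 0" using eq by (simp add: G_def)
  have Gle: "G t \<le> 0" if "x i + t \<ge> 0" for t
    using max[of "x(i := x i + t)"] x that by (simp add: G_def)
  have "D \<le> 0"
  proof (rule ccontr)
    assume "\<not> D \<le> 0"
    then obtain d where "d > 0" "\<forall>h>0. h < d \<longrightarrow> G 0 < G (0 + h)"
      using DERIV_pos_inc_right[OF G'] by force
    then have "0 < G (d/2)" using G0 by simp
    moreover have "x i + d / 2 \<ge> 0" using \<open>d > 0\<close> x[OF i] by simp
    ultimately show False using Gle by fastforce
  qed
  moreover have "D \<ge> 0"
  proof (cases "x i = 0")
    case True
    have "?T \<ge> 0" by (intro tensor_form_nonneg g x)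
    then show ?thesis using True k by (simp add: D_def power_0_left)
  next
    case False
    then have pos: "x i > 0" using x[OF i] by simp
    show ?thesis
    proof (rule ccontr)
      assume "\<not> D \<ge> 0"
      then obtain d where d: "d > 0" "\<forall>h>0. h < d \<longrightarrow> G 0 < G (0 - h)"
        using DERIV_neg_dec_left[OF G'] by force
      define h where "h = min (d/2) (x i)"
      have "h > 0" "h < d" "x i + (- h) \<ge> 0" using d pos by (auto simp: h_def)
      then show False using d(2) G0 Gle[of "-h"] by auto
    qed
  qed
  ultimately have "D = 0" by simp
  then show ?thesis using k by (simp add: D_def)
qed

lemma continuous_tensor_form: "continuous_on A (tensor_form n m g)"
proof -
  have "continuous_on A (\<lambda>x. tensor_form n m g x)"
  proof (induction m arbitrary: g)
    case 0
    then show ?case by (simp add: tensor_form_0)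
  next
    case (Suc m)
    have "continuous_on A (\<lambda>x::nat\<Rightarrow>real. x i)" for i
      by (rule continuous_on_subset[OF continuous_on_product_coordinates]) simp
    then show ?case unfolding tensor_form_Suc by (intro continuous_intros Suc.IH)
  qed
  then show ?thesis by simp
qed

lemma continuous_power_sum: "continuous_on A (power_sum n k)"
proof -
  have "continuous_on A (\<lambda>x::nat\<Rightarrow>real. x i)" for i
    by (rule continuous_on_subset[OF continuous_on_product_coordinates]) simp
  then have "continuous_on A (\<lambda>x. power_sum n k x)"
    unfolding power_sum_def by (intro continuous_intros)
  then show ?thesis by simp
qed

text \<open>The components outside \<open>{1..n}\<close> are irrelevant; setting them to \<open>0\<close> makes the domain of
  maximization compact in the product topology.\<close>
lemma exists_maximizer:
  assumes k: "k \<ge> 1" and n: "n \<ge> 1"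
  obtains x where "\<And>j. 0 \<le> x j" "power_sum n k x = 1"
    "\<And>z. (\<And>j. j \<in> {1..n} \<Longrightarrow> 0 \<le> z j) \<Longrightarrow>
        tensor_form n k g z \<le> tensor_form n k g x * power_sum n k z"
proof -
  define K :: "(nat \<Rightarrow> real) set" where "K = PiE UNIV (\<lambda>i. if i \<in> {1..n} then {0..1} else {0})"
  define X where "X = K \<inter> {x. power_sum n k x = 1}"
  have "compactin (product_topology (\<lambda>i. euclidean) UNIV) K"
    unfolding K_def by (subst compactin_PiE) auto
  then have "compact K" by (simp add: euclidean_product_topology)
  moreover have "closed {x. power_sum n k x = 1}"
    by (intro closed_Collect_eq continuous_power_sum continuous_intros)
  ultimately have cX: "compact X" unfolding X_def by (rule compact_Int_closed)
  have inX: "(\<lambda>j. if j \<in> {1..n} then z j else 0) \<in> X"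
    if "\<And>j. j \<in> {1..n} \<Longrightarrow> 0 \<le> z j" "power_sum n k z = 1" for z
  proof -
    have "z j \<le> 1" if j: "j \<in> {1..n}" for j
    proof (rule ccontr)
      assume "\<not> z j \<le> 1"
      then have "1 < z j ^ k" using k by (intro one_less_power) auto
      also have "\<dots> \<le> power_sum n k z" unfolding power_sum_def
        using j that(1) \<open>\<And>j. j \<in> {1..n} \<Longrightarrow> 0 \<le> z j\<close>
        by (intro member_le_sum) auto
      finally show False using \<open>power_sum n k z = 1\<close> by simp
    qed
    then show ?thesis using that by (auto simp: X_def K_def power_sum_def)
  qed
  have "power_sum n k (\<lambda>j. if j = 1 then 1 else 0) = 1"
    using k n by (simp add: power_sum_def if_distrib[of "\<lambda>a. a ^ k"] power_0_left cong: if_cong)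
  then have "X \<noteq> {}" using inX[of "\<lambda>j. if j = 1 then 1 else 0"] by force
  then obtain x where x: "x \<in> X" "\<And>z. z \<in> X \<Longrightarrow> tensor_form n k g z \<le> tensor_form n k g x"
    using continuous_attains_sup[OF cX _ continuous_tensor_form] by blast
  have max: "tensor_form n k g z \<le> tensor_form n k g x * power_sum n k z"
    if z: "\<And>j. j \<in> {1..n} \<Longrightarrow> 0 \<le> z j" for z
  proof (cases "power_sum n k z = 0")
    case True
    then have "z j ^ k = 0" if "j \<in> {1..n}" for j
      using z that sum_nonneg_eq_0_iff[of "{1..n}" "\<lambda>j. z j ^ k"] by (auto simp: power_sum_def)
    then have z0: "z j = 0" if "j \<in> {1..n}" for j using that by auto
    have "tensor_form n k g z = tensor_form n k g (\<lambda>j. 0 * z j)"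
      using z0 by (intro tensor_form_cong) auto
    then show ?thesis using True k tensor_form_scale[of n k g 0 z] by (simp add: power_0_left)
  next
    case False
    let ?N = "power_sum n k z"
    have N: "?N > 0" using False z by (auto simp: power_sum_def order_less_le intro!: sum_nonneg)
    define c where "c = 1 / root k ?N"
    have c: "c \<ge> 0" "c ^ k = 1 / ?N" using N k by (auto simp: c_def power_divide)
    let ?z = "\<lambda>j. c * z j"
    have "power_sum n k ?z = c ^ k * ?N"
      by (simp add: power_sum_def sum_distrib_left power_mult_distrib)
    then have "power_sum n k ?z = 1" using c N by simp
    then have "(\<lambda>j. if j \<in> {1..n} then ?z j else 0) \<in> X" using c z by (intro inX) auto
    then have "tensor_form n k g (\<lambda>j. if j \<in> {1..n} then ?z j else 0) \<le> tensor_form n k g x"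
      by (rule x(2))
    moreover have "tensor_form n k g (\<lambda>j. if j \<in> {1..n} then ?z j else 0) = tensor_form n k g ?z"
      by (rule tensor_form_cong) auto
    moreover have "tensor_form n k g ?z = tensor_form n k g z / ?N"
      by (simp add: tensor_form_scale c)
    ultimately have "tensor_form n k g z / ?N \<le> tensor_form n k g x" by simp
    then show ?thesis using N by (simp add: pos_divide_le_eq)
  qed
  have "x j \<in> (if j \<in> {1..n} then {0..1} else {0})" for j
    using x(1) unfolding X_def K_def by blast
  then have "0 \<le> x j" for j by (metis atLeastAtMost_iff order_refl singletonD)
  moreover have "power_sum n k x = 1" using x(1) by (auto simp: X_def)
  ultimately show thesis using max that by blast
qed

lemma tensor_apply_of_real:
  assumes "k \<ge> 1" "i \<in> {1..n}"
    and T: "\<And>js. length js = k \<Longrightarrow> set js \<subseteq> {1..n} \<Longrightarrow> T js = g (set js)"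
  shows "tensor_apply k n T (\<lambda>j. complex_of_real (x j)) i
       = complex_of_real (tensor_form n (k - 1) (\<lambda>S. g (insert i S)) x)"
proof -
  have p: "(\<Prod>j\<leftarrow>js. complex_of_real (x j)) = complex_of_real (\<Prod>j\<leftarrow>js. x j)" for js
    by (induction js) auto
  show ?thesis
    unfolding tensor_apply_def tensor_form_def p of_real_sum of_real_mult
    using assms by (intro sum.cong refl) auto
qed

text \<open>Taking moduli in the eigenvalue equation, multiplying by \<open>\<bar>x\<^sub>i\<bar>\<close> and summing compares an
  arbitrary complex eigenvalue with the maximum of the form.\<close>
lemma eigenvalue_bound:
  assumes k: "k \<ge> 1"
    and g: "\<And>S. g S \<ge> 0"
    and T: "\<And>js. length js = k \<Longrightarrow> set js \<subseteq> {1..n} \<Longrightarrow> T js = g (set js)"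
    and max: "\<And>z. (\<And>j. j \<in> {1..n} \<Longrightarrow> 0 \<le> z j) \<Longrightarrow> tensor_form n k g z \<le> M * power_sum n k z"
    and ev: "tensor_eigenvalue k n T lam"
  shows "cmod lam \<le> M"
proof -
  obtain x where x: "\<exists>i\<in>{1..n}. x i \<noteq> 0"
    and eq: "\<And>i. i \<in> {1..n} \<Longrightarrow> tensor_apply k n T x i = lam * x i ^ (k - 1)"
    using ev unfolding tensor_eigenvalue_def by blast
  let ?z = "\<lambda>j. cmod (x j)"
  have p: "cmod (\<Prod>j\<leftarrow>js. x j) = (\<Prod>j\<leftarrow>js. ?z j)" for js
    by (induction js) (auto simp: norm_mult)
  have le: "cmod lam * ?z i ^ (k - 1) \<le> tensor_form n (k - 1) (\<lambda>S. g (insert i S)) ?z"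
    if i: "i \<in> {1..n}" for i
  proof -
    have "cmod lam * ?z i ^ (k - 1) = cmod (tensor_apply k n T x i)"
      by (simp add: eq[OF i] norm_mult norm_power)
    also have "\<dots> \<le> (\<Sum>js | length js = k - 1 \<and> set js \<subseteq> {1..n}.
        cmod (complex_of_real (T (i # js)) * (\<Prod>j\<leftarrow>js. x j)))"
      unfolding tensor_apply_def by (rule norm_sum)
    also have "\<dots> = tensor_form n (k - 1) (\<lambda>S. g (insert i S)) ?z"
      unfolding tensor_form_def norm_mult p using T i k g by (intro sum.cong refl) auto
    finally show ?thesis .
  qed
  have k': "k = Suc (k - 1)" using k by simp
  have "cmod lam * power_sum n k ?z = (\<Sum>i=1..n. ?z i * (cmod lam * ?z i ^ (k - 1)))"
    unfolding power_sum_def sum_distrib_left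
    by (subst (1) k') (simp add: algebra_simps)
  also have "\<dots> \<le> (\<Sum>i=1..n. ?z i * tensor_form n (k - 1) (\<lambda>S. g (insert i S)) ?z)"
    using le by (intro sum_mono mult_left_mono) auto
  also have "\<dots> = tensor_form n k g ?z" using tensor_form_Suc[of n "k - 1" g ?z] k by simp
  also have "\<dots> \<le> M * power_sum n k ?z" by (rule max) simp
  finally have "cmod lam * power_sum n k ?z \<le> M * power_sum n k ?z" .
  moreover have "power_sum n k ?z > 0"
    unfolding power_sum_def using x by (auto intro!: sum_pos2)
  ultimately show ?thesis by simp
qed

text \<open>The spectral radius is attained by the form on the nonnegative part of the unit sphere of
  the \<open>k\<close>-norm, and it bounds the form there.\<close>
lemma spectral_radius_variational:
  assumes k: "k \<ge> 2" and n: "n \<ge> 1"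
    and g: "\<And>S. g S \<ge> 0"
    and T: "\<And>js. length js = k \<Longrightarrow> set js \<subseteq> {1..n} \<Longrightarrow> T js = g (set js)"
  shows "\<exists>x. (\<forall>j. 0 \<le> x j) \<and> power_sum n k x = 1
           \<and> tensor_form n k g x = tensor_spectral_radius k n T"
    and "(\<And>j. j \<in> {1..n} \<Longrightarrow> 0 \<le> z j) \<Longrightarrow>
           tensor_form n k g z \<le> tensor_spectral_radius k n T * power_sum n k z"
proof -
  obtain x where x: "\<And>j. 0 \<le> x j" "power_sum n k x = 1"
    and max: "\<And>z. (\<And>j. j \<in> {1..n} \<Longrightarrow> 0 \<le> z j) \<Longrightarrow>
        tensor_form n k g z \<le> tensor_form n k g x * power_sum n k z"
    using exists_maximizer[of k n g] k n by auto
  let ?M = "tensor_form n k g x"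
  have M: "?M \<ge> 0" by (intro tensor_form_nonneg g x)
  have eig: "tensor_form n (k - 1) (\<lambda>S. g (insert i S)) x = ?M * x i ^ (k - 1)"
    if "i \<in> {1..n}" for i
    using maximizer_eigen_equation[of k i n g x ?M] k that g x max by simp
  have "\<exists>i\<in>{1..n}. x i \<noteq> 0"
  proof (rule ccontr)
    assume "\<not> (\<exists>i\<in>{1..n}. x i \<noteq> 0)"
    then have "power_sum n k x = 0" using k by (simp add: power_sum_def power_0_left)
    then show False using x by simp
  qed
  moreover have "tensor_apply k n T (\<lambda>j. complex_of_real (x j)) i
      = complex_of_real ?M * complex_of_real (x i) ^ (k - 1)" if "i \<in> {1..n}" for i
    using tensor_apply_of_real[of k i n T g x] k that T eig[OF that] by simp
  ultimately have "tensor_eigenvalue k n T (complex_of_real ?M)"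
    unfolding tensor_eigenvalue_def
    by (intro exI[of _ "\<lambda>j. complex_of_real (x j)"]) auto
  then have "?M \<in> {cmod lam | lam. tensor_eigenvalue k n T lam}"
    using M by (auto intro!: exI[of _ "complex_of_real ?M"])
  moreover have "r \<le> ?M" if "r \<in> {cmod lam | lam. tensor_eigenvalue k n T lam}" for r
    using that eigenvalue_bound[of k g n T ?M] k g T max by auto
  ultimately have rho: "tensor_spectral_radius k n T = ?M"
    unfolding tensor_spectral_radius_def by (intro Greatest_equality) auto
  show "\<exists>x. (\<forall>j. 0 \<le> x j) \<and> power_sum n k x = 1
           \<and> tensor_form n k g x = tensor_spectral_radius k n T"
    using x rho by auto
  show "(\<And>j. j \<in> {1..n} \<Longrightarrow> 0 \<le> z j) \<Longrightarrow>
           tensor_form n k g z \<le> tensor_spectral_radius k n T * power_sum n k z"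
    using max rho by auto
qed

section \<open>Tensors that are sums over the edges\<close>

text \<open>The contribution of an edge \<open>f\<close> to a tensor entry with index set \<open>S\<close>: it vanishes unless
  \<open>S \<subseteq> f\<close>, and otherwise depends only on the number of distinct indices.  The adjacency tensor
  arises from \<open>h m = 1 / (k - 1)!\<close> for \<open>m = k\<close> and \<open>0\<close> otherwise, the degree tensor from
  \<open>h m = 1\<close> for \<open>m = 1\<close> and \<open>0\<close> otherwise, and the incidence tensor from the constant \<open>h m = 1\<close>.\<close>
definition edge_weight :: "(nat \<Rightarrow> real) \<Rightarrow> nat set \<Rightarrow> nat set \<Rightarrow> real" where
  "edge_weight h f S = (if S \<subseteq> f then h (card S) else 0)"

text \<open>The entry with index set \<open>S\<close> of the tensor of a hypergraph with edge set \<open>E\<close>.\<close>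
definition hyper_weight :: "(nat \<Rightarrow> real) \<Rightarrow> nat set set \<Rightarrow> nat set \<Rightarrow> real" where
  "hyper_weight h E S = (\<Sum>f\<in>E. edge_weight h f S)"

lemma edge_weight_nonneg: "(\<And>m. h m \<ge> 0) \<Longrightarrow> edge_weight h f S \<ge> 0"
  by (simp add: edge_weight_def)

lemma hyper_weight_nonneg: "(\<And>m. h m \<ge> 0) \<Longrightarrow> hyper_weight h E S \<ge> 0"
  by (simp add: hyper_weight_def edge_weight_nonneg sum_nonneg)

lemma edge_weight_image:
  assumes "inj \<sigma>"
  shows "edge_weight h (\<sigma> ` f) (\<sigma> ` S) = edge_weight h f S"
  using assms by (simp add: edge_weight_def inj_image_subset_iff card_image inj_on_subset)

lemma uniform_hypergraph_finite:
  assumes "uniform_hypergraph k n E"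
  shows "finite E" and "f \<in> E \<Longrightarrow> finite f"
proof -
  have "E \<subseteq> Pow {1..n}" using assms by (auto simp: uniform_hypergraph_def)
  then show "finite E" by (rule finite_subset) simp
  show "finite f" if "f \<in> E"
  proof (rule finite_subset)
    show "f \<subseteq> {1..n}" using assms that by (auto simp: uniform_hypergraph_def)
  qed simp
qed

text \<open>The contribution of the edge \<open>f\<close> to \<open>T x\<^sup>k\<close>.\<close>
definition edge_form :: "nat \<Rightarrow> nat \<Rightarrow> (nat \<Rightarrow> real) \<Rightarrow> nat set \<Rightarrow> (nat \<Rightarrow> real) \<Rightarrow> real" where
  "edge_form k n h f x = tensor_form n k (edge_weight h f) x"

text \<open>The contribution of the edge \<open>f\<close> to \<open>(T x)\<^sub>i\<close>; it vanishes when \<open>i \<notin> f\<close>.\<close>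
definition edge_partial ::
    "nat \<Rightarrow> nat \<Rightarrow> (nat \<Rightarrow> real) \<Rightarrow> nat \<Rightarrow> nat set \<Rightarrow> (nat \<Rightarrow> real) \<Rightarrow> real" where
  "edge_partial k n h i f x = tensor_form n (k - 1) (\<lambda>S. edge_weight h f (insert i S)) x"

lemma tensor_form_hyper_weight:
  "tensor_form n k (hyper_weight h E) x = (\<Sum>f\<in>E. edge_form k n h f x)"
  unfolding hyper_weight_def edge_form_def by (rule tensor_form_sum)

lemma tensor_form_hyper_weight_insert:
  "tensor_form n (k - 1) (\<lambda>S. hyper_weight h E (insert i S)) x
     = (\<Sum>f\<in>E. edge_partial k n h i f x)"
  unfolding hyper_weight_def edge_partial_def by (rule tensor_form_sum)

lemma edge_form_cong:
  assumes "\<And>j. j \<in> f \<Longrightarrow> x j = z j"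
  shows "edge_form k n h f x = edge_form k n h f z"
  unfolding edge_form_def using assms
  by (intro tensor_form_cong) (auto simp: edge_weight_def split: if_splits)

lemma edge_partial_cong:
  assumes "\<And>j. j \<in> f \<Longrightarrow> x j = z j"
  shows "edge_partial k n h i f x = edge_partial k n h i f z"
  unfolding edge_partial_def using assms
  by (intro tensor_form_cong) (auto simp: edge_weight_def split: if_splits)

lemma edge_form_mono:
  assumes "\<And>m. h m \<ge> 0" and "\<And>j. j \<in> f \<Longrightarrow> 0 \<le> x j \<and> x j \<le> z j"
  shows "edge_form k n h f x \<le> edge_form k n h f z"
  unfolding edge_form_def using assms
  by (intro tensor_form_mono) (auto simp: edge_weight_def split: if_splits)

lemma edge_form_image:
  assumes "\<sigma> permutes {1..n}"
  shows "edge_form k n h (\<sigma> ` f) y = edge_form k n h f (y \<circ> \<sigma>)"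
  unfolding edge_form_def
  by (subst tensor_form_permute[OF assms]) (simp add: edge_weight_image permutes_inj[OF assms])

lemma edge_partial_image:
  assumes "\<sigma> permutes {1..n}"
  shows "edge_partial k n h (\<sigma> i) (\<sigma> ` f) y = edge_partial k n h i f (y \<circ> \<sigma>)"
  unfolding edge_partial_def
  by (subst tensor_form_permute[OF assms])
    (simp add: edge_weight_image permutes_inj[OF assms] flip: image_insert)

lemma edge_partial_outside:
  assumes "i \<notin> f"
  shows "edge_partial k n h i f x = 0"
  using assms by (simp add: edge_partial_def tensor_form_def edge_weight_def)

lemma edge_partial_nonneg:
  assumes "\<And>m. h m \<ge> 0" and "\<And>j. 0 \<le> x j"
  shows "edge_partial k n h i f x \<ge> 0"
  unfolding edge_partial_def using assms by (intro tensor_form_nonneg edge_weight_nonneg)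

lemma prod_list_prod_real:
  fixes x :: "nat \<Rightarrow> real"
  assumes "distinct js"
  shows "(\<Prod>j\<leftarrow>js. x j) = (\<Prod>j\<in>set js. x j)"
  using assms by (rule prod.distinct_set_conv_list[symmetric])

lemma edge_partial_pos:
  assumes h: "\<And>m. h m \<ge> 0" "h k > 0" and x: "\<And>j. 0 \<le> x j" "\<And>j. j \<in> f \<Longrightarrow> 0 < x j"
    and f: "f \<subseteq> {1..n}" "card f = k" "i \<in> f"
  shows "edge_partial k n h i f x > 0"
proof -
  have fin: "finite f" using f(1) by (rule finite_subset) simp
  let ?js = "sorted_list_of_set (f - {i})"
  have js: "set ?js = f - {i}" "length ?js = k - 1" using fin f by auto
  show ?thesis unfolding edge_partial_def tensor_form_def
  proof (rule sum_pos2[of _ ?js])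
    show "?js \<in> {js. length js = k - 1 \<and> set js \<subseteq> {1..n}}" using js f by auto
    have "(\<Prod>j\<in>f - {i}. x j) > 0" using x by (intro prod_pos) auto
    then show "0 < edge_weight h f (insert i (set ?js)) * (\<Prod>j\<leftarrow>?js. x j)"
      using js f h fin by (simp add: prod_list_prod_real edge_weight_def insert_absorb)
    show "0 \<le> edge_weight h f (insert i (set js)) * (\<Prod>j\<leftarrow>js. x j)" for js
      by (intro mult_nonneg_nonneg edge_weight_nonneg prod_list_nonneg_real h x)
  qed (rule finite_index_lists)
qed

section \<open>Positivity of the maximizer\<close>

text \<open>Raising the zeros of \<open>x\<close> on an edge to \<open>t\<close> increases the form at least by a multiple of
  \<open>t\<^sup>a\<close>, where \<open>a\<close> is the number of these zeros: this is the term whose index list enumerates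
  the edge.\<close>
lemma edge_form_perturb:
  assumes h: "\<And>m. h m \<ge> 0" "h k > 0" and x: "\<And>j. 0 \<le> x j"
    and f: "f \<subseteq> {1..n}" "card f = k"
    and A: "A = {j \<in> f. x j = 0}" "A \<noteq> {}" and t: "t \<ge> 0"
  shows "edge_form k n h f (\<lambda>j. if j \<in> A then t else x j)
       \<ge> edge_form k n h f x + h k * (\<Prod>j\<in>f - A. x j) * t ^ card A"
proof -
  have fin: "finite f" using f(1) by (rule finite_subset) simp
  let ?z = "\<lambda>j. if j \<in> A then t else x j"
  let ?L = "{js. length js = k \<and> set js \<subseteq> {1..n}}"
  let ?js = "sorted_list_of_set f"
  let ?F = "\<lambda>x js. edge_weight h f (set js) * (\<Prod>j\<leftarrow>js. x j)"
  have js: "set ?js = f" "length ?js = k" "distinct ?js" using fin f by auto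
  have inL: "?js \<in> ?L" using js f by simp
  have mono: "?F x js \<le> ?F ?z js" for js
    using x t A by (intro mult_left_mono prod_list_mono_real edge_weight_nonneg h) auto
  have "(\<Prod>j\<leftarrow>?js. x j) = 0" using A fin js by (simp add: prod_list_prod_real) blast
  then have Fx: "?F x ?js = 0" by simp
  have "(\<Prod>j\<in>f. ?z j) = (\<Prod>j\<in>f - A. ?z j) * (\<Prod>j\<in>A. ?z j)"
    using fin A by (intro prod.subset_diff) auto
  also have "\<dots> = (\<Prod>j\<in>f - A. x j) * t ^ card A" by simp
  finally have "?F ?z ?js = h k * (\<Prod>j\<in>f - A. x j) * t ^ card A"
    using js f by (simp only: prod_list_prod_real[OF js(3)]) (simp add: edge_weight_def)
  moreover have "(\<Sum>js\<in>?L. ?F x js) = ?F x ?js + (\<Sum>js\<in>?L - {?js}. ?F x js)"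
    by (rule sum.remove[OF finite_index_lists inL])
  moreover have "(\<Sum>js\<in>?L. ?F ?z js) = ?F ?z ?js + (\<Sum>js\<in>?L - {?js}. ?F ?z js)"
    by (rule sum.remove[OF finite_index_lists inL])
  moreover have "(\<Sum>js\<in>?L - {?js}. ?F x js) \<le> (\<Sum>js\<in>?L - {?js}. ?F ?z js)"
    by (intro sum_mono mono)
  ultimately show ?thesis using Fx unfolding edge_form_def tensor_form_def by linarith
qed

text \<open>If \<open>x\<close> vanished at some but not all vertices of an edge, the perturbation above would gain
  order \<open>t\<^sup>a\<close> with \<open>a < k\<close> in the form, but only order \<open>t\<^sup>k\<close> in the power sum.\<close>
lemma maximizer_edge_all_or_nothing:
  assumes h: "\<And>m. h m \<ge> 0" "h k > 0" and x: "\<And>j. 0 \<le> x j"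
    and E: "uniform_hypergraph k n E" and f: "f \<in> E"
    and max: "\<And>z. (\<And>j. j \<in> {1..n} \<Longrightarrow> 0 \<le> z j) \<Longrightarrow>
       tensor_form n k (hyper_weight h E) z \<le> M * power_sum n k z"
    and eq: "tensor_form n k (hyper_weight h E) x = M * power_sum n k x"
    and i: "i \<in> f" "x i = 0" and j: "j \<in> f"
  shows "x j = 0"
proof (rule ccontr)
  assume xj: "x j \<noteq> 0"
  have f': "f \<subseteq> {1..n}" "card f = k" "finite f" and finE: "finite E"
    using E f uniform_hypergraph_finite[OF E] by (auto simp: uniform_hypergraph_def)
  define A where "A = {j \<in> f. x j = 0}"
  have A: "A \<noteq> {}" "A \<subset> f" "finite A" using i j xj f' by (auto simp: A_def)
  define a where "a = card A"
  have a: "a < k" using psubset_card_mono[OF f'(3) A(2)] f' by (simp add: a_def)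
  then have k: "k > 0" by simp
  define c where "c = h k * (\<Prod>j\<in>f - A. x j)"
  have "(\<Prod>j\<in>f - A. x j) > 0" using x by (intro prod_pos) (auto simp: A_def order_less_le)
  then have c: "c > 0" using h by (simp add: c_def)
  have key: "c * t ^ a \<le> M * (real a * t ^ k)" if t: "t \<ge> 0" for t
  proof -
    let ?z = "\<lambda>j. if j \<in> A then t else x j"
    have "tensor_form n k (hyper_weight h E) x + c * t ^ a
        = (edge_form k n h f x + c * t ^ a) + (\<Sum>f\<in>E - {f}. edge_form k n h f x)"
      unfolding tensor_form_hyper_weight sum.remove[OF finE f] by simp
    also have "\<dots> \<le> edge_form k n h f ?z + (\<Sum>f\<in>E - {f}. edge_form k n h f ?z)"
    proof (intro add_mono sum_mono edge_form_mono h)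
      show "edge_form k n h f x + c * t ^ a \<le> edge_form k n h f ?z"
        using edge_form_perturb[where h = h and x = x, OF h x f'(1,2) A_def A(1) t] by (simp add: c_def a_def)
      show "0 \<le> x j \<and> x j \<le> ?z j" for j using x t by (simp add: A_def)
    qed
    also have "\<dots> = tensor_form n k (hyper_weight h E) ?z"
      unfolding tensor_form_hyper_weight sum.remove[OF finE f] by simp
    also have "\<dots> \<le> M * power_sum n k ?z" using x t by (intro max) auto
    also have "power_sum n k ?z = power_sum n k x + real a * t ^ k"
    proof -
      have "power_sum n k ?z = (\<Sum>j=1..n. x j ^ k + (if j \<in> A then t ^ k else 0))"
        unfolding power_sum_def using k by (intro sum.cong) (auto simp: A_def)
      also have "\<dots> = power_sum n k x + (\<Sum>j\<in>{1..n} \<inter> A. t ^ k)"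
        by (simp only: sum.distrib power_sum_def sum.inter_restrict finite_atLeastAtMost)
      also have "{1..n} \<inter> A = A" using A f' by auto
      finally show ?thesis by (simp add: a_def)
    qed
    finally show ?thesis using eq by (simp add: algebra_simps)
  qed
  \<comment> \<open>A \<open>t\<close> so small that \<open>M a t\<^sup>k < c t\<^sup>a\<close>, using \<open>t\<^sup>k \<le> t\<^sup>a\<^sup>+\<^sup>1\<close>.\<close>
  define C where "C = \<bar>M\<bar> * real a + 1"
  define t where "t = min 1 (c / (2 * C))"
  have C: "C > 0" by (simp add: C_def add_nonneg_pos)
  have t: "t > 0" "t \<le> 1" "t * C < c" using c C by (auto simp: t_def min_def field_simps)
  have "c * t ^ a \<le> M * real a * t ^ k" using key[of t] t by (simp add: mult.assoc)
  also have "\<dots> \<le> C * t ^ k"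
    using t abs_ge_self[of M] by (intro mult_right_mono) (auto simp: C_def intro: order_trans[OF mult_right_mono])
  also have "\<dots> \<le> C * t ^ Suc a" using t a C by (intro mult_left_mono power_decreasing) auto
  also have "\<dots> = (t * C) * t ^ a" by simp
  also have "\<dots> < c * t ^ a" using t by (intro mult_strict_right_mono) auto
  finally show False by simp
qed

lemma walk_crossing_edge:
  assumes "hyper_walk E vs es" "P (hd vs)" "\<not> P (last vs)"
  obtains f a b where "f \<in> E" "a \<in> f" "b \<in> f" "P a" "\<not> P b"
proof -
  have len: "length vs = length es + 1" using assms by (simp add: hyper_walk_def)
  then have "vs \<noteq> []" by auto
  then have 0: "P (vs ! 0)" and l: "\<not> P (vs ! length es)"
    using assms len by (auto simp: hd_conv_nth last_conv_nth)
  have "\<exists>r<length es. P (vs ! r) \<and> \<not> P (vs ! (r + 1))"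
  proof (rule ccontr)
    assume "\<not> ?thesis"
    then have *: "P (vs ! r) \<Longrightarrow> P (vs ! (r + 1))" if "r < length es" for r using that by blast
    have "r \<le> length es \<Longrightarrow> P (vs ! r)" for r
      by (induction r) (use 0 * in auto)
    then show False using l by blast
  qed
  then obtain r where "r < length es" "P (vs ! r)" "\<not> P (vs ! (r + 1))" by blast
  moreover from this have "es ! r \<in> E" "vs ! r \<in> es ! r" "vs ! (r + 1) \<in> es ! r"
    using assms(1) by (auto simp: hyper_walk_def)
  ultimately show thesis using that by blast
qed

text \<open>In a connected hypergraph the zero set of a maximizer is therefore empty, since otherwise
  some edge would cross its boundary.\<close>
lemma maximizer_positive:
  assumes h: "\<And>m. h m \<ge> 0" "h k > 0" and x: "\<And>j. 0 \<le> x j" "power_sum n k x = 1"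
    and k: "k \<ge> 1"
    and E: "uniform_hypergraph k n E" "hyper_connected n E"
    and max: "\<And>z. (\<And>j. j \<in> {1..n} \<Longrightarrow> 0 \<le> z j) \<Longrightarrow>
       tensor_form n k (hyper_weight h E) z \<le> M * power_sum n k z"
    and eq: "tensor_form n k (hyper_weight h E) x = M"
    and i: "i \<in> {1..n}"
  shows "0 < x i"
proof (rule ccontr)
  assume "\<not> 0 < x i"
  then have xi: "x i = 0" using x(1)[of i] by simp
  have "\<exists>j\<in>{1..n}. x j \<noteq> 0"
  proof (rule ccontr)
    assume "\<not> ?thesis"
    then have "power_sum n k x = 0" using k by (simp add: power_sum_def power_0_left)
    then show False using x by simp
  qed
  then obtain j where j: "j \<in> {1..n}" "x j \<noteq> 0" by blast
  then have "i \<noteq> j" using xi by auto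
  then obtain vs es where "hyper_path E vs es" "hd vs = i" "last vs = j"
    using E(2) i j unfolding hyper_connected_def by blast
  then obtain f a b where f: "f \<in> E" "a \<in> f" "b \<in> f" "x a = 0" "x b \<noteq> 0"
    using walk_crossing_edge[of E vs es "\<lambda>v. x v = 0"] xi j by (auto simp: hyper_path_def)
  have "tensor_form n k (hyper_weight h E) x = M * power_sum n k x" using eq x(2) by simp
  from maximizer_edge_all_or_nothing[where h = h and x = x and M = M,
      OF h x(1) E(1) f(1) max this f(2,4,3)]
  show False using f(5) by simp
qed

section \<open>Edge-releasing in acyclic hypergraphs\<close>

lemma acyclic_linear:
  assumes "hyper_acyclic E" "f \<in> E" "g \<in> E" "f \<noteq> g" "v \<in> f \<inter> g" "w \<in> f \<inter> g"
  shows "v = w"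
proof (rule ccontr)
  assume "v \<noteq> w"
  then have "hyper_cycle E [v, w, v] [f, g]"
    using assms by (auto simp: hyper_cycle_def hyper_walk_def less_Suc_eq)
  then show False using assms(1) by (auto simp: hyper_acyclic_def)
qed

lemma acyclic_no_triangle:
  assumes "hyper_acyclic E" "f \<in> E" "g \<in> E" "e \<in> E" "distinct [f, g, e]" "distinct [a, b, c]"
    and "a \<in> e \<inter> f" "b \<in> f \<inter> g" "c \<in> g \<inter> e"
  shows False
proof -
  have "hyper_cycle E [a, b, c, a] [f, g, e]"
    using assms by (auto simp: hyper_cycle_def hyper_walk_def less_Suc_eq)
  then show False using assms(1) by (auto simp: hyper_acyclic_def)
qed

text \<open>The edge of the new hypergraph that comes from \<open>f\<close>.\<close>
definition released_edge :: "nat set set \<Rightarrow> nat set \<Rightarrow> nat \<Rightarrow> nat set \<Rightarrow> nat set" where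
  "released_edge E e u f =
     (if f \<in> edges_to_move E e u then (f - {the_elem (f \<inter> e)}) \<union> {u} else f)"

lemma edge_releasing_image: "edge_releasing E e u = released_edge E e u ` E"
proof -
  have sub: "edges_to_move E e u \<subseteq> E" by (auto simp: edges_to_move_def)
  then have "released_edge E e u ` E = released_edge E e u ` (E - edges_to_move E e u)
      \<union> released_edge E e u ` edges_to_move E e u" by blast
  moreover have "released_edge E e u ` (E - edges_to_move E e u) = id ` (E - edges_to_move E e u)"
    by (intro image_cong) (auto simp: released_edge_def)
  moreover have "released_edge E e u ` edges_to_move E e u
      = (\<lambda>f. (f - {the_elem (f \<inter> e)}) \<union> {u}) ` edges_to_move E e u"
    by (intro image_cong) (auto simp: released_edge_def)
  ultimately show ?thesis by (simp add: edge_releasing_def)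
qed

lemma acyclic_meeting_vertex:
  assumes "hyper_acyclic E" "e \<in> E" "f \<in> E" "f \<noteq> e" "f \<inter> e \<noteq> {}"
  obtains v where "f \<inter> e = {v}"
proof -
  obtain v where "v \<in> f \<inter> e" using assms by blast
  moreover have "w = v" if "w \<in> f \<inter> e" for w
    by (rule acyclic_linear[OF assms(1,3,2,4) that \<open>v \<in> f \<inter> e\<close>])
  ultimately have "f \<inter> e = {v}" by blast
  then show thesis by (rule that)
qed

text \<open>For an edge that meets \<open>e\<close> in \<open>v\<close>, moving it from \<open>v\<close> to \<open>u\<close> is the action of a
  transposition.  This includes the edges through \<open>u\<close>, which are not moved: there \<open>v = u\<close>.\<close>
lemma released_edge_meeting:
  assumes "f \<in> E" "f \<noteq> e" "f \<inter> e = {v}" "u \<in> e"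
  shows "released_edge E e u f = Transposition.transpose v u ` f"
proof -
  have v: "v \<in> f" and uf: "u \<in> f \<longleftrightarrow> u = v" using assms(3,4) by auto
  show ?thesis
  proof (cases "u = v")
    case True
    then have "f \<notin> edges_to_move E e u" using v by (simp add: edges_to_move_def)
    then show ?thesis using True by (simp add: released_edge_def)
  next
    case False
    then have "f \<in> edges_to_move E e u" using assms uf by (simp add: edges_to_move_def)
    then have "released_edge E e u f = insert u (f - {v})"
      using assms(3) by (simp add: released_edge_def)
    also have "\<dots> = Transposition.transpose v u ` insert v (f - {v})"
    proof -
      have "Transposition.transpose v u ` (f - {v}) = id ` (f - {v})"
        using uf by (intro image_cong) (auto simp: Transposition.transpose_def)
      then show ?thesis by (simp only: image_insert transpose_apply_first image_id id_apply)
    qed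
    also have "insert v (f - {v}) = f" using v by (rule insert_Diff)
    finally show ?thesis .
  qed
qed

lemma released_edge_same: "f = e \<or> f \<inter> e = {} \<Longrightarrow> released_edge E e u f = f"
  by (auto simp: released_edge_def edges_to_move_def)

lemma released_edge_uniform:
  assumes E: "uniform_hypergraph k n E" "hyper_acyclic E" and e: "e \<in> E" "u \<in> e" and f: "f \<in> E"
  shows "released_edge E e u f \<subseteq> {1..n} \<and> card (released_edge E e u f) = k"
proof (cases "f = e \<or> f \<inter> e = {}")
  case True
  then show ?thesis using E f by (simp add: released_edge_same uniform_hypergraph_def)
next
  case False
  then obtain v where v: "f \<inter> e = {v}" using acyclic_meeting_vertex[OF E(2) e(1) f] by blast
  have "e \<subseteq> {1..n}" using E e by (simp add: uniform_hypergraph_def)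
  moreover have "v \<in> e" using v by auto
  ultimately have "Transposition.transpose v u permutes {1..n}"
    using e by (intro permutes_swap_id) auto
  moreover have "f \<subseteq> {1..n}" using E f by (simp add: uniform_hypergraph_def)
  ultimately have "Transposition.transpose v u ` f \<subseteq> {1..n}"
    using permutes_image image_mono[of f "{1..n}" "Transposition.transpose v u"] by blast
  moreover have "card (Transposition.transpose v u ` f) = card f"
    by (rule card_image[OF inj_on_subset[OF inj_transpose subset_UNIV]])
  ultimately show ?thesis
    using released_edge_meeting[of f E e v u] False f v e E by (simp add: uniform_hypergraph_def)
qed

text \<open>No two edges become equal: a coincidence would produce a cycle of length three, formed by \<open>e\<close>
  and the two edges, which share a vertex \<open>p\<close> outside \<open>e\<close> because \<open>k \<ge> 2\<close>.\<close>
lemma released_edge_inj: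
  assumes E: "uniform_hypergraph k n E" "hyper_acyclic E" and e: "e \<in> E" "u \<in> e" and k: "k \<ge> 2"
  shows "inj_on (released_edge E e u) E"
proof -
  let ?M = "edges_to_move E e u"
  have moved: "\<exists>v p. f \<inter> e = {v} \<and> released_edge E e u f = (f - {v}) \<union> {u}
      \<and> p \<in> f \<and> p \<notin> e \<and> u \<notin> f \<and> f \<in> E \<and> f \<noteq> e" if f: "f \<in> ?M" for f
  proof -
    have f': "f \<in> E" "f \<noteq> e" "f \<inter> e \<noteq> {}" "u \<notin> f" using f by (auto simp: edges_to_move_def)
    then obtain v where v: "f \<inter> e = {v}" using acyclic_meeting_vertex[OF E(2) e(1)] by blast
    have "\<not> f \<subseteq> {v}" using card_mono[of "{v}" f] k E f'(1) by (auto simp: uniform_hypergraph_def)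
    then obtain p where "p \<in> f" "p \<noteq> v" by blast
    then show ?thesis using v f f' by (auto simp: released_edge_def)
  qed
  have mixed: "released_edge E e u f \<noteq> g" if f: "f \<in> ?M" and g: "g \<in> E" "g \<notin> ?M" for f g
  proof
    assume eq: "released_edge E e u f = g"
    obtain v p where v: "f \<inter> e = {v}" "g = (f - {v}) \<union> {u}" "p \<in> f" "p \<notin> e" "u \<notin> f" "f \<in> E" "f \<noteq> e"
      using moved[OF f] eq by blast
    have p: "p \<in> g" "p \<noteq> v" "p \<noteq> u" "v \<noteq> u" "g \<noteq> e" "g \<noteq> f" "u \<in> g"
      using v e by auto
    then show False
      using acyclic_no_triangle[OF E(2) v(6) g(1) e(1), of v p u] v e by auto
  qed
  have both: "f = g" if f: "f \<in> ?M" and g: "g \<in> ?M"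
    and eq: "released_edge E e u f = released_edge E e u g" for f g
  proof (rule ccontr)
    assume ne: "f \<noteq> g"
    obtain v p where v: "f \<inter> e = {v}" "released_edge E e u f = (f - {v}) \<union> {u}"
      "p \<in> f" "p \<notin> e" "u \<notin> f" "f \<in> E" "f \<noteq> e"
      using moved[OF f] by blast
    obtain w where w: "g \<inter> e = {w}" "released_edge E e u g = (g - {w}) \<union> {u}"
      "u \<notin> g" "g \<in> E" "g \<noteq> e"
      using moved[OF g] by blast
    have fg: "f - {v} = g - {w}" using eq v w by auto
    have vw: "v \<noteq> w" using fg ne v(1) w(1) by (metis IntD1 insertI1 insert_Diff)
    have "p \<in> f - {v}" using v by auto
    then have "p \<in> g" using fg by blast
    then show False
      using acyclic_no_triangle[OF E(2) v(6) w(4) e(1), of v p w] v w vw ne by auto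
  qed
  show ?thesis
  proof (rule inj_onI)
    fix f g assume fg: "f \<in> E" "g \<in> E" "released_edge E e u f = released_edge E e u g"
    have un: "released_edge E e u f = f" if "f \<notin> ?M" for f using that by (simp add: released_edge_def)
    show "f = g"
      using fg mixed[of f g] mixed[of g f] both[of f g] un[of f] un[of g] by metis
  qed
qed

text \<open>If all neighbouring edges met \<open>e\<close> in \<open>w\<close>, then \<open>w\<close> would be the only vertex of \<open>e\<close> of
  degree greater than one.  There is at least one neighbouring edge because some edge is moved.\<close>
lemma nonpendent_edge_off_vertex:
  assumes E: "uniform_hypergraph k n E" "hyper_acyclic E" and e: "e \<in> E" "\<not> pendent_edge k E e"
    and moved: "edges_to_move E e u \<noteq> {}" and w: "w \<in> e"
  obtains f v where "f \<in> E" "f \<noteq> e" "f \<inter> e = {v}" "v \<noteq> w"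
proof -
  have "\<exists>f\<in>E. f \<noteq> e \<and> f \<inter> e \<noteq> {} \<and> w \<notin> f"
  proof (rule ccontr)
    assume *: "\<not> ?thesis"
    have finE: "finite E" and fine: "finite e" using uniform_hypergraph_finite[OF E(1)] e by auto
    have deg: "vertex_degree E v = 1" if v: "v \<in> e" "v \<noteq> w" for v
    proof -
      have "g = e" if g: "g \<in> E" "v \<in> g" for g
      proof (rule ccontr)
        assume "g \<noteq> e"
        then have "w \<in> g" using * g v by blast
        then show False using acyclic_linear[OF E(2) g(1) e(1) \<open>g \<noteq> e\<close>, of v w] g v w by auto
      qed
      then have "{g \<in> E. v \<in> g} = {e}" using e(1) v(1) by blast
      then show ?thesis by (simp add: vertex_degree_def)
    qed
    obtain f where f: "f \<in> E" "f \<noteq> e" "f \<inter> e \<noteq> {}" using moved by (auto simp: edges_to_move_def)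
    then have "w \<in> f" using * by blast
    then have "{f, e} \<subseteq> {g \<in> E. w \<in> g}" using f e w by auto
    then have "card {f, e} \<le> vertex_degree E w"
      unfolding vertex_degree_def using finE by (intro card_mono) auto
    then have "vertex_degree E w \<noteq> 1" using f by simp
    then have "{v \<in> e. vertex_degree E v = 1} = e - {w}" using deg by blast
    then have "card {v \<in> e. vertex_degree E v = 1} = k - 1"
      using w fine E(1) e(1) by (simp add: uniform_hypergraph_def)
    then show False using e(2) by (simp add: pendent_edge_def)
  qed
  then obtain f where f: "f \<in> E" "f \<noteq> e" "f \<inter> e \<noteq> {}" "w \<notin> f" by blast
  then obtain v where "f \<inter> e = {v}" using acyclic_meeting_vertex[OF E(2) e(1)] by blast
  then show thesis using that f by blast
qed

section \<open>Comparison of the spectral radii\<close>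

text \<open>The condition \<open>h k > 0\<close> says that the product of \<open>x\<close> over an edge occurs in the form
  with a positive coefficient; it makes the maximizer positive and the comparison strict.\<close>
theorem spectral_radius_edge_releasing:
  assumes k: "k \<ge> 2" and E: "uniform_supertree k n E"
    and e: "e \<in> E" "\<not> pendent_edge k E e" "u \<in> e" "edges_to_move E e u \<noteq> {}"
    and h: "\<And>m. h m \<ge> 0" "h k > 0"
    and T: "\<And>js. length js = k \<Longrightarrow> set js \<subseteq> {1..n} \<Longrightarrow> T js = hyper_weight h E (set js)"
    and T': "\<And>js. length js = k \<Longrightarrow> set js \<subseteq> {1..n} \<Longrightarrow>
        T' js = hyper_weight h (edge_releasing E e u) (set js)"
  shows "tensor_spectral_radius k n T < tensor_spectral_radius k n T'"
proof (rule ccontr)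
  assume "\<not> ?thesis"
  then have le: "tensor_spectral_radius k n T' \<le> tensor_spectral_radius k n T" by simp
  let ?rho = "tensor_spectral_radius k n T"
  let ?rho' = "tensor_spectral_radius k n T'"
  let ?E' = "edge_releasing E e u"
  let ?r = "released_edge E e u"
  have uE: "uniform_hypergraph k n E" and cE: "hyper_connected n E" and aE: "hyper_acyclic E"
    using E by (auto simp: uniform_supertree_def)
  have finE: "finite E" by (rule uniform_hypergraph_finite(1)[OF uE])
  have sub: "f \<subseteq> {1..n}" "card f = k" if "f \<in> E" for f
    using uE that by (auto simp: uniform_hypergraph_def)
  have un: "u \<in> {1..n}" using sub e by blast
  then have n: "n \<ge> 1" by simp
  have inj: "inj_on ?r E" by (rule released_edge_inj[OF uE aE e(1,3) k])
  have sum': "(\<Sum>f\<in>?E'. F f) = (\<Sum>f\<in>E. F (?r f))" for F :: "nat set \<Rightarrow> real"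
    unfolding edge_releasing_image by (rule sum.reindex_cong[OF inj]) auto
  note H = hyper_weight_nonneg[of h, OF h(1)]
  note var = spectral_radius_variational[where g = "hyper_weight h E" and T = T, OF k n H T]
  note var' = spectral_radius_variational[where g = "hyper_weight h ?E'" and T = T', OF k n H T']
  from var(1) obtain x where x: "\<And>j. 0 \<le> x j" "power_sum n k x = 1"
    and xmax: "tensor_form n k (hyper_weight h E) x = ?rho" by blast
  have max: "tensor_form n k (hyper_weight h E) z \<le> ?rho * power_sum n k z"
    if "\<And>j. j \<in> {1..n} \<Longrightarrow> 0 \<le> z j" for z
    by (rule var(2)[OF _ _ that])
  have max': "tensor_form n k (hyper_weight h ?E') z \<le> ?rho' * power_sum n k z"
    if "\<And>j. j \<in> {1..n} \<Longrightarrow> 0 \<le> z j" for z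
    by (rule var'(2)[OF _ _ that])
  have xpos: "0 < x i" if "i \<in> {1..n}" for i
  proof -
    have "k \<ge> 1" using k by simp
    then show ?thesis
      by (rule maximizer_positive[where h = h and x = x and M = ?rho, OF h x _ uE cE max xmax that])
  qed
  have fine: "finite e" "e \<noteq> {}" using uniform_hypergraph_finite(2)[OF uE e(1)] e by auto
  obtain w where w: "w \<in> e" "\<And>v. v \<in> e \<Longrightarrow> x v \<le> x w"
  proof -
    have "Max (x ` e) \<in> x ` e" using fine by (intro Max_in) auto
    then obtain w where "w \<in> e" "x w = Max (x ` e)" by auto
    then show thesis using fine by (intro that) auto
  qed
  \<comment> \<open>The test vector gives \<open>u\<close> the largest value of \<open>x\<close> on \<open>e\<close>; the
    contribution of \<open>e\<close> itself is unchanged by this exchange.\<close>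
  define \<pi> where "\<pi> = Transposition.transpose u w"
  define y where "y = x \<circ> \<pi>"
  have perm: "Transposition.transpose a b permutes {1..n}" if "a \<in> e" "b \<in> e" for a b
    using that sub[OF e(1)] by (intro permutes_swap_id) auto
  have \<pi>: "\<pi> permutes {1..n}" unfolding \<pi>_def by (rule perm[OF e(3) w(1)])
  have \<pi>e: "\<pi> ` e = e" unfolding \<pi>_def using e w by simp
  have y: "0 \<le> y j" "power_sum n k y = 1" "y u = x w" for j
    using x power_sum_permute[OF \<pi>, of k x] by (simp_all add: y_def \<pi>_def)
  have yout: "y j = x j" if "j \<notin> e" for j
    using that e w by (auto simp: y_def \<pi>_def Transposition.transpose_def)
  have meet: "?r f = Transposition.transpose v u ` f"
    "\<And>j. j \<in> f \<Longrightarrow> (y \<circ> Transposition.transpose v u) j = (if j = v then x w else x j)"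
    if f: "f \<in> E" "f \<noteq> e" "f \<inter> e = {v}" for f v
  proof -
    show "?r f = Transposition.transpose v u ` f" by (rule released_edge_meeting[OF f e(3)])
    fix j assume j: "j \<in> f"
    show "(y \<circ> Transposition.transpose v u) j = (if j = v then x w else x j)"
    proof (cases "j = v")
      case False
      then have "j \<notin> e" using f j by blast
      moreover from this have "j \<noteq> u" using e by blast
      ultimately show ?thesis using False yout by simp
    qed (use y in simp)
  qed
  have form_le: "edge_form k n h f x \<le> edge_form k n h (?r f) y" if f: "f \<in> E" for f
  proof -
    consider "f = e" | "f \<inter> e = {}" | v where "f \<noteq> e" "f \<inter> e = {v}"
      using acyclic_meeting_vertex[OF aE e(1) f] by blast
    then show ?thesis
    proof cases
      case 1
      have "edge_form k n h e y = edge_form k n h e x"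
        using edge_form_image[OF \<pi>, of k h e x] by (simp add: \<pi>e y_def)
      then show ?thesis using 1 by (simp add: released_edge_same)
    next
      case 2
      then have "edge_form k n h f x = edge_form k n h f y"
        by (intro edge_form_cong yout[symmetric]) blast
      then show ?thesis using 2 by (simp add: released_edge_same)
    next
      case 3
      then have v: "v \<in> e" by blast
      have "edge_form k n h f x \<le> edge_form k n h f (y \<circ> Transposition.transpose v u)"
        using meet(2)[OF f 3] x w v by (intro edge_form_mono h) auto
      also have "\<dots> = edge_form k n h (?r f) y"
        using meet(1)[OF f 3] edge_form_image[OF perm[OF v e(3)], of k h f y] by simp
      finally show ?thesis .
    qed
  qed
  have "?rho \<le> tensor_form n k (hyper_weight h ?E') y"
    unfolding xmax[symmetric] tensor_form_hyper_weight sum' by (intro sum_mono form_le)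
  moreover have "tensor_form n k (hyper_weight h ?E') y \<le> ?rho'" using max'[of y] y by simp
  ultimately have rho: "?rho' = ?rho" and ymax: "tensor_form n k (hyper_weight h ?E') y = ?rho"
    using le by auto
  \<comment> \<open>Now \<open>y\<close> is a maximizer as well; its eigenvalue equation at \<open>u\<close> is incompatible with
    that of \<open>x\<close> at \<open>w\<close>.\<close>
  have "w \<in> {1..n}" using w(1) sub[OF e(1)] by blast
  then have eqx: "(\<Sum>f\<in>E. edge_partial k n h w f x) = ?rho * x w ^ (k - 1)"
    unfolding tensor_form_hyper_weight_insert[symmetric]
    by (rule maximizer_eigen_equation[OF k _ H x(1) max]) (simp_all only: xmax x mult_1_right)
  have "tensor_form n (k - 1) (\<lambda>S. hyper_weight h ?E' (insert u S)) y = ?rho * y u ^ (k - 1)"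
    by (rule maximizer_eigen_equation[OF k un H y(1) max'[unfolded rho]])
      (simp_all only: ymax y mult_1_right)
  then have eqy: "(\<Sum>f\<in>E. edge_partial k n h u (?r f) y) = ?rho * y u ^ (k - 1)"
    unfolding tensor_form_hyper_weight_insert sum' .
  have partial_le: "edge_partial k n h w f x \<le> edge_partial k n h u (?r f) y" if f: "f \<in> E" for f
  proof (cases "w \<in> f")
    case False
    then show ?thesis using h y by (simp add: edge_partial_outside edge_partial_nonneg)
  next
    case True
    have "edge_partial k n h w f x = edge_partial k n h u (?r f) y"
    proof (cases "f = e")
      case True
      have "\<pi> u = w" by (simp add: \<pi>_def)
      then have "edge_partial k n h w e x = edge_partial k n h u e y"
        using edge_partial_image[OF \<pi>, of k h u e x] unfolding \<pi>e y_def by (simp only:)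
      moreover have "?r f = e" using True by (simp add: released_edge_same)
      ultimately show ?thesis using True by (simp only:)
    next
      case False
      then have fw: "f \<inter> e = {w}"
        using acyclic_linear[OF aE f e(1) False, of w] w(1) \<open>w \<in> f\<close> by blast
      have "edge_partial k n h w f x = edge_partial k n h w f (y \<circ> Transposition.transpose w u)"
        using meet(2)[OF f False fw] by (intro edge_partial_cong) auto
      also have "\<dots> = edge_partial k n h u (?r f) y"
        using meet(1)[OF f False fw] edge_partial_image[OF perm[OF w(1) e(3)], of k h w f y] by simp
      finally show ?thesis .
    qed
    then show ?thesis by simp
  qed
  obtain f v where f: "f \<in> E" "f \<noteq> e" "f \<inter> e = {v}" "v \<noteq> w"
    by (rule nonpendent_edge_off_vertex[OF uE aE e(1,2,4) w(1)])
  have "w \<notin> f" using f(3,4) w(1) by auto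
  then have "edge_partial k n h w f x = 0" by (rule edge_partial_outside)
  moreover have "0 < edge_partial k n h u (?r f) y"
  proof (rule edge_partial_pos[where h = h and x = y, OF h y(1)])
    show rf: "?r f \<subseteq> {1..n}" "card (?r f) = k"
      using released_edge_uniform[OF uE aE e(1,3) f(1)] by auto
    have "v \<in> f" using f(3) by auto
    then show "u \<in> ?r f" unfolding meet(1)[OF f(1-3)] by (metis image_eqI transpose_apply_first)
    show "0 < y j" if "j \<in> ?r f" for j
      using that rf xpos permutes_in_image[OF \<pi>, of j] by (auto simp: y_def)
  qed
  ultimately have "\<exists>f\<in>E. edge_partial k n h w f x < edge_partial k n h u (?r f) y"
    using f(1) by (intro bexI[of _ f]) simp_all
  then have "(\<Sum>f\<in>E. edge_partial k n h w f x) < (\<Sum>f\<in>E. edge_partial k n h u (?r f) y)"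
    using partial_le by (intro sum_strict_mono_ex1[OF finE] ballI)
  then show False using eqx eqy y by simp
qed

section \<open>The adjacency, signless Laplacian and incidence tensors\<close>

lemma adjacency_tensor_hyper_weight:
  assumes "uniform_hypergraph k n E"
  shows "adjacency_tensor k E js
       = hyper_weight (\<lambda>m. if m = k then 1 / fact (k - 1) else 0) E (set js)"
proof -
  have "edge_weight (\<lambda>m. if m = k then 1 / fact (k - 1) else 0) f (set js)
      = (if f = set js then 1 / fact (k - 1) else 0)" if f: "f \<in> E" for f
  proof -
    have "card f = k" "finite f"
      using assms f uniform_hypergraph_finite[OF assms] by (auto simp: uniform_hypergraph_def)
    then show ?thesis using card_subset_eq[of f "set js"] by (auto simp: edge_weight_def)
  qed
  then have "hyper_weight (\<lambda>m. if m = k then 1 / fact (k - 1) else 0) E (set js)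
      = (\<Sum>f\<in>E. if f = set js then 1 / fact (k - 1) else 0)"
    unfolding hyper_weight_def by (intro sum.cong refl) 
  then show ?thesis
    using uniform_hypergraph_finite(1)[OF assms] by (simp add: adjacency_tensor_def)
qed

lemma degree_tensor_hyper_weight:
  assumes "finite E" "js \<noteq> []"
  shows "degree_tensor E js = hyper_weight (\<lambda>m. if m = 1 then 1 else 0) E (set js)"
proof -
  obtain i js' where js: "js = i # js'" using assms(2) by (cases js) auto
  show ?thesis
  proof (cases "\<forall>j\<in>set js'. j = i")
    case True
    then have "set js = {i}" using js by auto
    then have "hyper_weight (\<lambda>m. if m = 1 then 1 else 0) E (set js) = (\<Sum>f\<in>E. if i \<in> f then 1 else 0)"
      by (simp add: hyper_weight_def edge_weight_def)
    also have "\<dots> = real (vertex_degree E i)"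
      using assms(1) by (simp add: vertex_degree_def sum.If_cases Int_def)
    finally show ?thesis using True js by (simp add: degree_tensor_def)
  next
    case False
    then have "card (set js) \<noteq> 1" using js by (auto simp: card_1_singleton_iff)
    then show ?thesis using False js by (auto simp: degree_tensor_def hyper_weight_def edge_weight_def)
  qed
qed

lemma signless_laplacian_tensor_hyper_weight:
  assumes "uniform_hypergraph k n E" "js \<noteq> []"
  shows "signless_laplacian_tensor k E js
       = hyper_weight (\<lambda>m. (if m = 1 then 1 else 0) + (if m = k then 1 / fact (k - 1) else 0)) E (set js)"
proof -
  have "edge_weight (\<lambda>m. g m + h m) f S = edge_weight g f S + edge_weight h f S" for g h f S
    by (simp add: edge_weight_def)
  then show ?thesis
    using uniform_hypergraph_finite(1)[OF assms(1)] assms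
    by (simp add: signless_laplacian_tensor_def degree_tensor_hyper_weight
        adjacency_tensor_hyper_weight hyper_weight_def sum.distrib)
qed

lemma incidence_Q_tensor_hyper_weight:
  assumes "finite E"
  shows "incidence_Q_tensor E js = hyper_weight (\<lambda>m. 1) E (set js)"
  using assms
  by (simp add: incidence_Q_tensor_def hyper_weight_def edge_weight_def sum.If_cases Int_def subset_eq)

theorem theorem18:
  fixes k n u :: nat and E E' :: "nat set set" and e :: "nat set"
  assumes "k \<ge> 2"
    and "uniform_supertree k n E"
    and "e \<in> E"
    and "\<not> pendent_edge k E e"
    and "u \<in> e"
    and "edges_to_move E e u \<noteq> {}"
    and "E' = edge_releasing E e u"
  shows "tensor_spectral_radius k n (adjacency_tensor k E')
           > tensor_spectral_radius k n (adjacency_tensor k E) \<and>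
         tensor_spectral_radius k n (signless_laplacian_tensor k E')
           > tensor_spectral_radius k n (signless_laplacian_tensor k E) \<and>
         tensor_spectral_radius k n (incidence_Q_tensor E')
           > tensor_spectral_radius k n (incidence_Q_tensor E)"
proof -
  have uE: "uniform_hypergraph k n E" and aE: "hyper_acyclic E"
    using assms(2) by (auto simp: uniform_supertree_def)
  have uE': "uniform_hypergraph k n E'"
    using released_edge_uniform[OF uE aE assms(3,5)]
    unfolding assms(7) edge_releasing_image uniform_hypergraph_def by blast
  note fin = uniform_hypergraph_finite(1)[OF uE] uniform_hypergraph_finite(1)[OF uE']
  have ne: "js \<noteq> []" if "length js = k" for js :: "nat list" using that assms(1) by auto
  note main = spectral_radius_edge_releasing[OF assms(1-6), folded assms(7)]
  show ?thesis
    by (intro conjI;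
        rule main[OF _ _ adjacency_tensor_hyper_weight[OF uE] adjacency_tensor_hyper_weight[OF uE']]
             main[OF _ _ signless_laplacian_tensor_hyper_weight[OF uE ne]
                       signless_laplacian_tensor_hyper_weight[OF uE' ne]]
             main[OF _ _ incidence_Q_tensor_hyper_weight[OF fin(1)]
                       incidence_Q_tensor_hyper_weight[OF fin(2)]];
        simp)
qed

end
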